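(* Let $F$ be an algebraically closed field of characteristic different from $2$ and $3$, and let $\mathbb{M}$ be the simple non-Lie Malcev algebra over $F$. Let $r\in\mathbb{M}\otimes\mathbb{M}$ be an antisymmetric solution (that is, $\tau(r)=-r$) to the classical Yang-Baxter equation $C_{\mathbb{M}}(r)=0$ on $\mathbb{M}$. Then the pair $(\mathbb{M},\Delta_r)$ is a Malcev bialgebra. Moreover, the radical $R$ of its Drinfeld double $D(\mathbb{M})$ is nonzero.
   Context: A Malcev algebra is an anticommutative algebra satisfying $J(x,y,xz)=J(x,y,z)x$, where $J(x,y,z)=(xy)z+(yz)x+(zx)y$. The algebra $\mathbb{M}$ is, up to isomorphism, the unique simple non-Lie Malcev algebra over $F$; it is $7$-dimensional with a (standard) basis $h,x,x',y,y',z,z'$ and anticommutative multiplication $hx=2x,\ hy=2y,\ hz=2z,\ hx'=-2x',\ hy'=-2y',\ hz'=-2z',\ xx'=yy'=zz'=h,\ xy=2z',\ yz=2x',\ zx=2y',\ x'y'=-2z,\ y'z'=-2x,\ z'x'=-2y$, other products of basis elements (not determined by anticommutativity) being zero. $\tau$ is the flip $\tau(u\otimes v)=v\otimes u$. For $r=\sum_i a_i\otimes b_i\in \mathbb{M}\otimes \mathbb{M}$: $\Delta_r(a)=\sum_i (a_ia\otimes b_i-a_i\otimes ab_i)$ and $C_{\mathbb{M}}(r)=\sum_{i,j}(a_ia_j\otimes b_i\otimes b_j-a_i\otimes a_jb_i\otimes b_j+a_i\otimes a_j\otimes b_ib_j)$. Malcev bialgebra: given an algebra $A$ with a linear map $\Delta:A\to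 A\otimes A$, $\Delta(a)=\sum a_{(1)}\otimes a_{(2)}$, the dual algebra is $A^*$ with product $\langle fg,a\rangle=\sum\langle f,a_{(1)}\rangle\langle g,a_{(2)}\rangle$. The Drinfeld double is $D(A)=A\oplus A^*$ with product $(a+f)(b+g)=(ab+f\rightharpoonup b+a\leftharpoonup g)+(fg+f\leftharpoondown b+a\rightharpoondown g)$, where $f\rightharpoonup a=\sum a_{(1)}\langle f,a_{(2)}\rangle$, $a\leftharpoonup f=\sum\langle f,a_{(1)}\rangle a_{(2)}$, $\langle f\leftharpoondown a,b\rangle=\langle f,ab\rangle$, $\langle b\rightharpoondown f,a\rangle=\langle f,ab\rangle$. For a Malcev algebra $M$ with comultiplication $\Delta$, $(M,\Delta)$ is a Malcev bialgebra if $D(M)$ is a Malcev algebra. The radical means the solvable radical (largest solvable ideal). *)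

theory Defs
  imports
    "HOL-Analysis.Analysis"
    "HOL-Computational_Algebra.Computational_Algebra"
begin

section \<open>Malcev algebras, ideals and the solvable radical\<close>

text \<open>
  An algebra is given by a scalar multiplication \<open>s\<close> on an abelian group together with a
  product \<open>m\<close>; it is not assumed to be associative.
\<close>

definition algebra_over :: "('k::field \<Rightarrow> 'v::ab_group_add \<Rightarrow> 'v) \<Rightarrow> ('v \<Rightarrow> 'v \<Rightarrow> 'v) \<Rightarrow> bool" where
  "algebra_over s m \<longleftrightarrow> vector_space s \<and>
     (\<forall>a. Vector_Spaces.linear s s (\<lambda>b. m a b)) \<and>
     (\<forall>b. Vector_Spaces.linear s s (\<lambda>a. m a b))"

definition jacobian :: "('v::ab_group_add \<Rightarrow> 'v \<Rightarrow> 'v) \<Rightarrow> 'v \<Rightarrow> 'v \<Rightarrow> 'v \<Rightarrow> 'v" where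
  "jacobian m x y z = m (m x y) z + m (m y z) x + m (m z x) y"

definition malcev_algebra :: "('k::field \<Rightarrow> 'v::ab_group_add \<Rightarrow> 'v) \<Rightarrow> ('v \<Rightarrow> 'v \<Rightarrow> 'v) \<Rightarrow> bool" where
  "malcev_algebra s m \<longleftrightarrow> algebra_over s m \<and>
     (\<forall>x y. m x y = - m y x) \<and>
     (\<forall>x y z. jacobian m x y (m x z) = m (jacobian m x y z) x)"

definition algebra_ideal ::
  "('k::field \<Rightarrow> 'v::ab_group_add \<Rightarrow> 'v) \<Rightarrow> ('v \<Rightarrow> 'v \<Rightarrow> 'v) \<Rightarrow> 'v set \<Rightarrow> bool" where
  "algebra_ideal s m I \<longleftrightarrow> module.subspace s I \<and> (\<forall>a. \<forall>u\<in>I. m a u \<in> I \<and> m u a \<in> I)"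

primrec derived_series ::
  "('k::field \<Rightarrow> 'v::ab_group_add \<Rightarrow> 'v) \<Rightarrow> ('v \<Rightarrow> 'v \<Rightarrow> 'v) \<Rightarrow> 'v set \<Rightarrow> nat \<Rightarrow> 'v set" where
  "derived_series s m I 0 = I"
| "derived_series s m I (Suc n) =
     module.span s {m u v | u v. u \<in> derived_series s m I n \<and> v \<in> derived_series s m I n}"

definition solvable_ideal ::
  "('k::field \<Rightarrow> 'v::ab_group_add \<Rightarrow> 'v) \<Rightarrow> ('v \<Rightarrow> 'v \<Rightarrow> 'v) \<Rightarrow> 'v set \<Rightarrow> bool" where
  "solvable_ideal s m I \<longleftrightarrow> algebra_ideal s m I \<and> (\<exists>n. derived_series s m I n = {0})"

text \<open>There is at most one \<open>R\<close> with the following property, by antisymmetry of inclusion.\<close>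

definition is_solvable_radical ::
  "('k::field \<Rightarrow> 'v::ab_group_add \<Rightarrow> 'v) \<Rightarrow> ('v \<Rightarrow> 'v \<Rightarrow> 'v) \<Rightarrow> 'v set \<Rightarrow> bool" where
  "is_solvable_radical s m R \<longleftrightarrow>
     solvable_ideal s m R \<and> (\<forall>I. solvable_ideal s m I \<longrightarrow> I \<subseteq> R)"


section \<open>Tensors and duals in coordinates\<close>

text \<open>
  For the space \<open>A = 'k ^ 'n\<close> with standard basis \<open>axis i 1\<close>, the tensor powers are modelled by
  their coordinates with respect to the induced bases.
\<close>

definition tensor2 :: "'k::field ^ 'n::finite \<Rightarrow> 'k ^ 'n \<Rightarrow> 'k ^ ('n \<times> 'n)" where
  "tensor2 u v = (\<chi> p. u $ fst p * v $ snd p)"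

definition tensor3 ::
  "'k::field ^ 'n::finite \<Rightarrow> 'k ^ 'n \<Rightarrow> 'k ^ 'n \<Rightarrow> 'k ^ ('n \<times> 'n \<times> 'n)" where
  "tensor3 u v w = (\<chi> p. u $ fst p * v $ fst (snd p) * w $ snd (snd p))"

abbreviation bvec :: "'n::finite \<Rightarrow> 'k::field ^ 'n" where
  "bvec i \<equiv> axis i 1"

text \<open>
  Every \<open>t\<close> is the sum of \<open>t $ p *s tensor2 (bvec (fst p)) (bvec (snd p))\<close> over all \<open>p\<close>
  (\<open>tensor2_expansion\<close> below). Expressions given by a representation \<open>\<Sum> a\<^sub>i \<otimes> b\<^sub>i\<close> of \<open>t\<close> are
  defined through this one; the lemmas show that every other representation gives the same result.
\<close>

definition flip :: "'k::field ^ ('n::finite \<times> 'n) \<Rightarrow> 'k ^ ('n \<times> 'n)" where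
  "flip t = (\<Sum>p\<in>UNIV. t $ p *s tensor2 (bvec (snd p)) (bvec (fst p)))"

definition Delta ::
  "('k::field ^ 'n::finite \<Rightarrow> 'k ^ 'n \<Rightarrow> 'k ^ 'n) \<Rightarrow> 'k ^ ('n \<times> 'n) \<Rightarrow> 'k ^ 'n \<Rightarrow> 'k ^ ('n \<times> 'n)" where
  "Delta m r a = (\<Sum>p\<in>UNIV. r $ p *s
     (tensor2 (m (bvec (fst p)) a) (bvec (snd p)) - tensor2 (bvec (fst p)) (m a (bvec (snd p)))))"

definition cybe ::
  "('k::field ^ 'n::finite \<Rightarrow> 'k ^ 'n \<Rightarrow> 'k ^ 'n) \<Rightarrow> 'k ^ ('n \<times> 'n) \<Rightarrow> 'k ^ ('n \<times> 'n \<times> 'n)" where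
  "cybe m r = (\<Sum>p\<in>UNIV. \<Sum>q\<in>UNIV. (r $ p * r $ q) *s
     (tensor3 (m (bvec (fst p)) (bvec (fst q))) (bvec (snd p)) (bvec (snd q))
      - tensor3 (bvec (fst p)) (m (bvec (fst q)) (bvec (snd p))) (bvec (snd q))
      + tensor3 (bvec (fst p)) (bvec (fst q)) (m (bvec (snd p)) (bvec (snd q)))))"

text \<open>
  The dual space \<open>A\<^sup>*\<close> is modelled by coordinates with respect to the dual basis, so it is again
  \<open>'k ^ 'n\<close>; a functional acts on \<open>A\<close> by \<open>pairing\<close>, and \<open>dual_of\<close> turns a linear functional into
  its coordinate vector.
\<close>

definition pairing :: "'k::field ^ 'n::finite \<Rightarrow> 'k ^ 'n \<Rightarrow> 'k" where
  "pairing f a = (\<Sum>i\<in>UNIV. f $ i * a $ i)"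

definition dual_of :: "('k::field ^ 'n::finite \<Rightarrow> 'k) \<Rightarrow> 'k ^ 'n" where
  "dual_of \<phi> = (\<chi> i. \<phi> (bvec i))"

text \<open>The maps \<open>f \<otimes> id\<close>, \<open>id \<otimes> f\<close> and \<open>f \<otimes> g\<close> on \<open>A \<otimes> A\<close>.\<close>

definition contract_left :: "'k::field ^ 'n::finite \<Rightarrow> 'k ^ ('n \<times> 'n) \<Rightarrow> 'k ^ 'n" where
  "contract_left f t = (\<Sum>p\<in>UNIV. t $ p *s (pairing f (bvec (fst p)) *s bvec (snd p)))"

definition contract_right :: "'k::field ^ 'n::finite \<Rightarrow> 'k ^ ('n \<times> 'n) \<Rightarrow> 'k ^ 'n" where
  "contract_right f t = (\<Sum>p\<in>UNIV. t $ p *s (pairing f (bvec (snd p)) *s bvec (fst p)))"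

definition pairing2 :: "'k::field ^ 'n::finite \<Rightarrow> 'k ^ 'n \<Rightarrow> 'k ^ ('n \<times> 'n) \<Rightarrow> 'k" where
  "pairing2 f g t = (\<Sum>p\<in>UNIV. t $ p * (pairing f (bvec (fst p)) * pairing g (bvec (snd p))))"


section \<open>Drinfeld double and Malcev bialgebras\<close>

text \<open>
  In the following \<open>m\<close> is the product and \<open>D\<close> the comultiplication of \<open>A\<close>. The names of the
  actions record the sides: \<open>f \<rightharpoonup> a\<close> and \<open>a \<leftharpoonup> f\<close> take values in \<open>A\<close>, while
  \<open>f \<leftharpoondown> a\<close> and \<open>a \<rightharpoondown> f\<close> take values in \<open>A\<^sup>*\<close>.
\<close>

definition dual_mult ::
  "('k::field ^ 'n::finite \<Rightarrow> 'k ^ ('n \<times> 'n)) \<Rightarrow> 'k ^ 'n \<Rightarrow> 'k ^ 'n \<Rightarrow> 'k ^ 'n" where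
  "dual_mult D f g = dual_of (\<lambda>a. pairing2 f g (D a))"

definition harpoon_up_right ::
  "('k::field ^ 'n::finite \<Rightarrow> 'k ^ ('n \<times> 'n)) \<Rightarrow> 'k ^ 'n \<Rightarrow> 'k ^ 'n \<Rightarrow> 'k ^ 'n" where
  "harpoon_up_right D f a = contract_right f (D a)"

definition harpoon_up_left ::
  "('k::field ^ 'n::finite \<Rightarrow> 'k ^ ('n \<times> 'n)) \<Rightarrow> 'k ^ 'n \<Rightarrow> 'k ^ 'n \<Rightarrow> 'k ^ 'n" where
  "harpoon_up_left D a f = contract_left f (D a)"

definition harpoon_down_left ::
  "('k::field ^ 'n::finite \<Rightarrow> 'k ^ 'n \<Rightarrow> 'k ^ 'n) \<Rightarrow> 'k ^ 'n \<Rightarrow> 'k ^ 'n \<Rightarrow> 'k ^ 'n" where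
  "harpoon_down_left m f a = dual_of (\<lambda>b. pairing f (m a b))"

definition harpoon_down_right ::
  "('k::field ^ 'n::finite \<Rightarrow> 'k ^ 'n \<Rightarrow> 'k ^ 'n) \<Rightarrow> 'k ^ 'n \<Rightarrow> 'k ^ 'n \<Rightarrow> 'k ^ 'n" where
  "harpoon_down_right m b f = dual_of (\<lambda>a. pairing f (m a b))"

definition double_scale ::
  "'k::field \<Rightarrow> ('k ^ 'n::finite) \<times> ('k ^ 'n) \<Rightarrow> ('k ^ 'n) \<times> ('k ^ 'n)" where
  "double_scale c v = (c *s fst v, c *s snd v)"

text \<open>The pair \<open>(a, f)\<close> stands for the element \<open>a + f\<close> of \<open>A \<oplus> A\<^sup>*\<close>.\<close>

fun double_mult ::
  "('k::field ^ 'n::finite \<Rightarrow> 'k ^ 'n \<Rightarrow> 'k ^ 'n) \<Rightarrow> ('k ^ 'n \<Rightarrow> 'k ^ ('n \<times> 'n)) \<Rightarrow>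
   ('k ^ 'n) \<times> ('k ^ 'n) \<Rightarrow> ('k ^ 'n) \<times> ('k ^ 'n) \<Rightarrow> ('k ^ 'n) \<times> ('k ^ 'n)" where
  "double_mult m D (a, f) (b, g) =
     (m a b + harpoon_up_right D f b + harpoon_up_left D a g,
      dual_mult D f g + harpoon_down_left m f b + harpoon_down_right m a g)"

definition malcev_bialgebra ::
  "('k::field ^ 'n::finite \<Rightarrow> 'k ^ 'n \<Rightarrow> 'k ^ 'n) \<Rightarrow> ('k ^ 'n \<Rightarrow> 'k ^ ('n \<times> 'n)) \<Rightarrow> bool" where
  "malcev_bialgebra m D \<longleftrightarrow> malcev_algebra (*s) m \<and> Vector_Spaces.linear (*s) (*s) D \<and>
     malcev_algebra double_scale (double_mult m D)"


section \<open>The simple non-Lie Malcev algebra\<close>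

datatype mbasis = H | X | X' | Y | Y' | Z | Z'

lemma UNIV_mbasis: "UNIV = {H, X, X', Y, Y', Z, Z'}"
  using mbasis.exhaust by auto

instance mbasis :: finite
  by standard (simp add: UNIV_mbasis)

text \<open>
  Each unordered pair of basis elements with nonzero product is listed once, in the order of the
  standard multiplication table; antisymmetrising gives all products of basis elements.
\<close>

fun M_table :: "mbasis \<Rightarrow> mbasis \<Rightarrow> 'k::field ^ mbasis" where
  "M_table H X = 2 *s bvec X"
| "M_table H Y = 2 *s bvec Y"
| "M_table H Z = 2 *s bvec Z"
| "M_table H X' = (-2) *s bvec X'"
| "M_table H Y' = (-2) *s bvec Y'"
| "M_table H Z' = (-2) *s bvec Z'"
| "M_table X X' = bvec H"
| "M_table Y Y' = bvec H"
| "M_table Z Z' = bvec H"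
| "M_table X Y = 2 *s bvec Z'"
| "M_table Y Z = 2 *s bvec X'"
| "M_table Z X = 2 *s bvec Y'"
| "M_table X' Y' = (-2) *s bvec Z"
| "M_table Y' Z' = (-2) *s bvec X"
| "M_table Z' X' = (-2) *s bvec Y"
| "M_table _ _ = 0"

definition M_mult :: "'k::field ^ mbasis \<Rightarrow> 'k ^ mbasis \<Rightarrow> 'k ^ mbasis" where
  "M_mult u v = (\<Sum>i\<in>UNIV. \<Sum>j\<in>UNIV. (u $ i * v $ j) *s (M_table i j - M_table j i))"


section \<open>Independence of the chosen representations\<close>

lemma linear_expand:
  fixes L :: "'k::field ^ 'n::finite \<Rightarrow> 'k ^ 'm::finite"
  assumes "Vector_Spaces.linear (*s) (*s) L"
  shows "L t = (\<Sum>i\<in>UNIV. t $ i *s L (bvec i))"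
proof -
  interpret L: Vector_Spaces.linear "(*s)" "(*s)" L by fact
  have "L t = L (\<Sum>i\<in>UNIV. t $ i *s bvec i)"
    by (simp add: basis_expansion)
  then show ?thesis
    by (simp add: L.sum L.scale)
qed

lemma tensor2_bvec: "tensor2 (bvec i) (bvec j) = (bvec (i, j) :: 'k::field ^ ('n::finite \<times> 'n))"
  by (auto simp: tensor2_def axis_def vec_eq_iff)

lemma tensor2_expansion:
  "t = (\<Sum>p\<in>UNIV. t $ p *s tensor2 (bvec (fst p)) (bvec (snd p)))"
  for t :: "'k::field ^ ('n::finite \<times> 'n)"
  by (simp add: tensor2_bvec basis_expansion)

lemma bilinear_expand:
  fixes B :: "'k::field ^ 'n::finite \<Rightarrow> 'k ^ 'n \<Rightarrow> 'k ^ 'm::finite"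
  assumes "\<And>a. Vector_Spaces.linear (*s) (*s) (\<lambda>b. B a b)"
    and "\<And>b. Vector_Spaces.linear (*s) (*s) (\<lambda>a. B a b)"
  shows "(\<Sum>p\<in>UNIV. (\<Sum>k\<in>K. tensor2 (a k) (b k)) $ p *s B (bvec (fst p)) (bvec (snd p)))
    = (\<Sum>k\<in>K. B (a k) (b k))"
proof -
  have one: "(\<Sum>p\<in>UNIV. tensor2 u v $ p *s B (bvec (fst p)) (bvec (snd p))) = B u v" for u v
  proof -
    have "B u v = (\<Sum>i\<in>UNIV. u $ i *s (\<Sum>j\<in>UNIV. v $ j *s B (bvec i) (bvec j)))"
      by (subst linear_expand[OF assms(2)], subst linear_expand[OF assms(1)]) simp
    also have "\<dots> = (\<Sum>p\<in>UNIV \<times> UNIV. tensor2 u v $ p *s B (bvec (fst p)) (bvec (snd p)))"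
      unfolding sum.cartesian_product' by (simp add: vec.scale_sum_right tensor2_def)
    finally show ?thesis
      by simp
  qed
  show ?thesis
    by (subst one[symmetric], subst sum.swap) (simp add: vec.scale_sum_left)
qed

lemma flip_sum: "flip (\<Sum>k\<in>K. tensor2 (a k) (b k)) = (\<Sum>k\<in>K. tensor2 (b k) (a k))"
  unfolding flip_def
  by (rule bilinear_expand[where B = "\<lambda>u v. tensor2 v u"]; unfold_locales)
    (auto simp: tensor2_def vec_eq_iff algebra_simps)

lemma contract_right_sum:
  "contract_right f (\<Sum>k\<in>K. tensor2 (a k) (b k)) = (\<Sum>k\<in>K. pairing f (b k) *s a k)"
  unfolding contract_right_def
  by (rule bilinear_expand[where B = "\<lambda>u v. pairing f v *s u"]; unfold_locales)
    (auto simp: pairing_def vec_eq_iff algebra_simps sum.distrib sum_distrib_left)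

lemma contract_left_sum:
  "contract_left f (\<Sum>k\<in>K. tensor2 (a k) (b k)) = (\<Sum>k\<in>K. pairing f (a k) *s b k)"
  unfolding contract_left_def
  by (rule bilinear_expand[where B = "\<lambda>u v. pairing f u *s v"]; unfold_locales)
    (auto simp: pairing_def vec_eq_iff algebra_simps sum.distrib sum_distrib_left)

lemma pairing_bvec: "pairing f (bvec i) = f $ i"
  by (simp add: pairing_def axis_def if_distrib[of "\<lambda>x. _ * x"] cong: if_cong)

lemma pairing2_sum:
  "pairing2 f g (\<Sum>k\<in>K. tensor2 (a k) (b k)) = (\<Sum>k\<in>K. pairing f (a k) * pairing g (b k))"
proof -
  have one: "(\<Sum>p\<in>UNIV. tensor2 u v $ p * (f $ fst p * g $ snd p)) = pairing f u * pairing g v" for u v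
    unfolding pairing_def sum_product UNIV_Times_UNIV[symmetric]
    by (subst sum.cartesian_product') (simp add: tensor2_def mult_ac)
  show ?thesis
    unfolding pairing2_def pairing_bvec
    by (subst one[symmetric], subst sum.swap) (simp add: sum_distrib_right)
qed

lemma Delta_sum:
  assumes "algebra_over (*s) m"
  shows "Delta m (\<Sum>k\<in>K. tensor2 (a k) (b k)) c
    = (\<Sum>k\<in>K. tensor2 (m (a k) c) (b k) - tensor2 (a k) (m c (b k)))"
proof -
  have l: "m u (v + w) = m u v + m u w" "m u (d *s v) = d *s m u v"
    and r: "m (v + w) u = m v u + m w u" "m (d *s v) u = d *s m v u" for d u v w
    using assms
    by (auto simp: algebra_over_def Vector_Spaces.linear_iff)
  show ?thesis
    unfolding Delta_def
    by (rule bilinear_expand[where B = "\<lambda>u v. tensor2 (m u c) v - tensor2 u (m c v)"]; unfold_locales)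
      (auto simp: tensor2_def vec_eq_iff algebra_simps l r)
qed

lemma cybe_sum:
  assumes "algebra_over (*s) m"
  shows "cybe m (\<Sum>k\<in>K. tensor2 (a k) (b k)) = (\<Sum>i\<in>K. \<Sum>j\<in>K.
    tensor3 (m (a i) (a j)) (b i) (b j) - tensor3 (a i) (m (a j) (b i)) (b j)
      + tensor3 (a i) (a j) (m (b i) (b j)))"
proof -
  have l: "m u (v + w) = m u v + m u w" "m u (d *s v) = d *s m u v"
    and r: "m (v + w) u = m v u + m w u" "m (d *s v) u = d *s m v u" for d u v w
    using assms
    by (auto simp: algebra_over_def Vector_Spaces.linear_iff)
  let ?r = "\<Sum>k\<in>K. tensor2 (a k) (b k)"
  define B where "B u v u' v' = tensor3 (m u u') v v' - tensor3 u (m u' v) v'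
      + tensor3 u u' (m v v')" for u v u' v'
  have inner: "(\<Sum>q\<in>UNIV. ?r $ q *s B u v (bvec (fst q)) (bvec (snd q)))
      = (\<Sum>j\<in>K. B u v (a j) (b j))" for u v
    by (rule bilinear_expand; unfold_locales)
      (auto simp: B_def tensor3_def vec_eq_iff algebra_simps l r)
  have "cybe m ?r = (\<Sum>p\<in>UNIV. ?r $ p *s
      (\<Sum>q\<in>UNIV. ?r $ q *s B (bvec (fst p)) (bvec (snd p)) (bvec (fst q)) (bvec (snd q))))"
    unfolding cybe_def B_def by (simp only: vec.scale_sum_right vec.scale_scale)
  also have "\<dots> = (\<Sum>p\<in>UNIV. ?r $ p *s
      (\<Sum>j\<in>K. B (bvec (fst p)) (bvec (snd p)) (a j) (b j)))"
    by (simp only: inner)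
  also have "\<dots> = (\<Sum>i\<in>K. \<Sum>j\<in>K. B (a i) (b i) (a j) (b j))"
    by (rule bilinear_expand[where B = "\<lambda>u v. \<Sum>j\<in>K. B u v (a j) (b j)"]; unfold_locales)
      (auto simp: B_def tensor3_def vec_eq_iff algebra_simps l r sum.distrib sum_subtractf
        sum_distrib_left)
  finally show ?thesis
    by (simp only: B_def)
qed

lemma pairing_dual_of:
  assumes "Vector_Spaces.linear (*s) (*) \<phi>"
  shows "pairing (dual_of \<phi>) a = \<phi> a"
proof -
  interpret L: Vector_Spaces.linear "(*s)" "(*)" \<phi> by fact
  have "\<phi> a = \<phi> (\<Sum>i\<in>UNIV. a $ i *s bvec i)"
    by (simp add: basis_expansion)
  then show ?thesis
    by (simp add: L.sum L.scale pairing_def dual_of_def mult.commute)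
qed

end

theory Submission
  imports Defs
begin

text \<open>
  Let \<open>\<rho> : A\<^sup>* \<rightarrow> A\<close> be the map defined by \<open>r\<close>. The Yang-Baxter equation together with antisymmetry
  says that \<open>\<rho>\<close> is multiplicative, so \<open>a + f \<mapsto> a + \<rho>(f)\<close> is a homomorphism from the double onto \<open>A\<close>,
  and it identifies the double with the split null extension of \<open>A\<close> by the bimodule \<open>A\<^sup>*\<close>. The algebra
  \<open>\<M>\<close> carries a nondegenerate invariant form \<open>B\<close>, so \<open>\<M>\<^sup>*\<close> is the regular bimodule and the double is
  \<open>\<M>[\<epsilon>]\<close> with \<open>\<epsilon>\<^sup>2 = 0\<close>, which inherits the Malcev identity from \<open>\<M>\<close>. The identity itself follows
  from \<open>(ua)a = 2(B(a,a)u - B(a,u)a)\<close>. As \<open>\<M>\<close> is simple and perfect, the abelian ideal \<open>\<epsilon>\<M>\<close> is the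
  radical.
\<close>

no_notation fps_nth (infixl \<open>$\<close> 75)

section \<open>Bilinear products, pullbacks of Malcev algebras and dual numbers\<close>

lemma algebra_over_simps:
  assumes "algebra_over s m"
  shows "m u (v + w) = m u v + m u w" "m u (s c v) = s c (m u v)"
    and "m (v + w) u = m v u + m w u" "m (s c v) u = s c (m v u)"
    and "m u 0 = 0" "m 0 u = 0" "m u (- v) = - m u v" "m (- v) u = - m v u"
    and "m u (v - w) = m u v - m u w" "m (v - w) u = m v u - m w u"
    and "m u (sum f K) = (\<Sum>k\<in>K. m u (f k))" "m (sum f K) u = (\<Sum>k\<in>K. m (f k) u)"
proof -
  interpret l: Vector_Spaces.linear s s "\<lambda>b. m u b"
    using assms by (simp add: algebra_over_def)
  interpret r: Vector_Spaces.linear s s "\<lambda>a. m a u"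
    using assms by (simp add: algebra_over_def)
  show "m u (v + w) = m u v + m u w" "m u (s c v) = s c (m u v)"
    and "m (v + w) u = m v u + m w u" "m (s c v) u = s c (m v u)"
    and "m u 0 = 0" "m 0 u = 0" "m u (- v) = - m u v" "m (- v) u = - m v u"
    and "m u (v - w) = m u v - m u w" "m (v - w) u = m v u - m w u"
    and "m u (sum f K) = (\<Sum>k\<in>K. m u (f k))" "m (sum f K) u = (\<Sum>k\<in>K. m (f k) u)"
    by (simp_all add: l.add l.scale l.zero l.neg l.diff l.sum r.add r.scale r.zero r.neg r.diff r.sum)
qed

text \<open>Bilinearity, anticommutativity and the Malcev identity are equations, and an injective
  homomorphism reflects equations from its target.\<close>

lemma malcev_algebra_pullback:
  assumes M: "malcev_algebra s' m'" and \<phi>: "Vector_Spaces.linear s s' \<phi>" "inj \<phi>"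
    and hom: "\<And>x y. \<phi> (m x y) = m' (\<phi> x) (\<phi> y)"
  shows "malcev_algebra s m"
proof -
  interpret \<phi>: Vector_Spaces.linear s s' \<phi> by fact
  have alg: "algebra_over s' m'" and anti: "\<And>x y. m' x y = - m' y x"
    and malcev: "\<And>x y z. jacobian m' x y (m' x z) = m' (jacobian m' x y z) x"
    using M unfolding malcev_algebra_def by blast+
  note m'_simps = algebra_over_simps[OF alg]
  have eqI: "u = v" if "\<phi> u = \<phi> v" for u v
    using \<open>inj \<phi>\<close> that by (rule injD)
  have jac: "\<phi> (jacobian m x y z) = jacobian m' (\<phi> x) (\<phi> y) (\<phi> z)" for x y z
    by (simp add: jacobian_def \<phi>.add hom)
  have lin: "Vector_Spaces.linear s s (\<lambda>b. m a b)" "Vector_Spaces.linear s s (\<lambda>b. m b a)" for a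
    by (auto simp: Vector_Spaces.linear_iff \<phi>.vs1.vector_space_axioms \<phi>.add \<phi>.scale hom
        m'_simps intro!: eqI)
  have "m x y = - m y x" for x y
    by (rule eqI) (metis \<phi>.neg anti hom)
  moreover have "jacobian m x y (m x z) = m (jacobian m x y z) x" for x y z
    by (rule eqI) (simp add: jac hom malcev)
  ultimately show ?thesis
    using lin \<phi>.vs1.vector_space_axioms unfolding malcev_algebra_def algebra_over_def
    by (intro conjI allI)
qed

text \<open>The algebra \<open>A[\<epsilon>]\<close> with \<open>\<epsilon>\<^sup>2 = 0\<close>; the pair \<open>(p, q)\<close> stands for \<open>p + \<epsilon>q\<close>.\<close>

definition dual_number_mult :: "('v::ab_group_add \<Rightarrow> 'v \<Rightarrow> 'v) \<Rightarrow> 'v \<times> 'v \<Rightarrow> 'v \<times> 'v \<Rightarrow> 'v \<times> 'v" where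
  "dual_number_mult m u v = (m (fst u) (fst v), m (fst u) (snd v) + m (snd u) (fst v))"

lemma vector_space_double_scale: "vector_space double_scale"
  by unfold_locales (auto simp: double_scale_def vec.scale_right_distrib vec.scale_left_distrib)

text \<open>The Malcev identity is linear in \<open>y\<close> and \<open>z\<close> and quadratic in
  \<open>x\<close>. Its part at epsilon is thus the identity with the second component of
  \<open>y\<close> or of \<open>z\<close> inserted, plus the linearisation \<open>pol\<close> in
  \<open>x\<close>. The latter is the identity at \<open>x + w\<close> minus those at
  \<open>x\<close> and \<open>w\<close>, so no division is involved.\<close>

lemma malcev_algebra_dual_number_mult:
  fixes m :: "'k::field ^ 'n::finite \<Rightarrow> 'k ^ 'n \<Rightarrow> 'k ^ 'n"
  assumes M: "malcev_algebra (*s) m"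
  shows "malcev_algebra double_scale (dual_number_mult m)"
proof -
  have alg: "algebra_over (*s) m" and anti: "\<And>x y. m x y = - m y x"
    and malcev: "\<And>x y z. jacobian m x y (m x z) = m (jacobian m x y z) x"
    using M unfolding malcev_algebra_def by blast+
  note m_simps = algebra_over_simps[OF alg]
  have lin: "Vector_Spaces.linear double_scale double_scale (\<lambda>b. dual_number_mult m a b)"
    "Vector_Spaces.linear double_scale double_scale (\<lambda>b. dual_number_mult m b a)" for a
    by (auto simp: Vector_Spaces.linear_iff vector_space_double_scale dual_number_mult_def
        m_simps double_scale_def vec.scale_right_distrib)
  have J_add: "jacobian m (x + x') y z = jacobian m x y z + jacobian m x' y z"
    "jacobian m x (y + y') z = jacobian m x y z + jacobian m x y' z"
    "jacobian m x y (z + z') = jacobian m x y z + jacobian m x y z'" for x x' y y' z z'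
    by (simp_all add: jacobian_def m_simps algebra_simps)
  have pol: "jacobian m x y (m w z) + jacobian m w y (m x z)
      = m (jacobian m x y z) w + m (jacobian m w y z) x" for x y z w
    using malcev[of "x + w" y z] by (simp add: J_add m_simps malcev add_ac)
  have jac: "jacobian (dual_number_mult m) x y z = (jacobian m (fst x) (fst y) (fst z),
      jacobian m (fst x) (fst y) (snd z) + jacobian m (fst x) (snd y) (fst z)
        + jacobian m (snd x) (fst y) (fst z))" for x y z
    by (simp add: jacobian_def dual_number_mult_def m_simps algebra_simps)
  have "jacobian (dual_number_mult m) x y (dual_number_mult m x z)
      = dual_number_mult m (jacobian (dual_number_mult m) x y z) x" for x y z
    using pol[of "fst x" "fst y" "snd x" "fst z"]
    by (simp add: jac, simp add: dual_number_mult_def J_add m_simps malcev algebra_simps)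
  moreover have "dual_number_mult m x y = - dual_number_mult m y x" for x y
    using anti[of "fst x" "fst y"] anti[of "fst x" "snd y"] anti[of "snd x" "fst y"]
    by (simp add: dual_number_mult_def)
  ultimately show ?thesis
    using lin vector_space_double_scale unfolding malcev_algebra_def algebra_over_def
    by (intro conjI allI)
qed

section \<open>The Malcev identity from a cross product identity\<close>

text \<open>Modulo terms containing \<open>B\<close>, the product \<open>m (m u a) b\<close> changes
  sign when \<open>a\<close> and \<open>b\<close> are exchanged. This reduces the Jacobian to a
  single triple product, and both sides of the Malcev identity become 3(((xy)z)x -
  2B(x,z)xy).\<close>

lemma malcev_algebra_if_cross_product:
  fixes m :: "'k::field ^ 'n::finite \<Rightarrow> 'k ^ 'n \<Rightarrow> 'k ^ 'n"
  assumes alg: "algebra_over (*s) m" and anti: "\<And>x y. m x y = - m y x" and m_self: "\<And>x. m x x = 0"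
    and B_add: "\<And>x y z. B (x + y) z = B x z + B y z"
    and B_sym: "\<And>x y. B x y = B y x"
    and B_inv: "\<And>x y z. B (m x y) z = B x (m y z)"
    and cross: "\<And>u a. m (m u a) a = 2 *s (B a a *s u - B a u *s a)"
  shows "malcev_algebra (*s) m"
proof -
  note m_simps = algebra_over_simps[OF alg]
  note scale_simps = vec.scale_right_distrib vec.scale_left_distrib vec.scale_right_diff_distrib
    vec.scale_left_diff_distrib
  have B_add': "B z (x + y) = B z x + B z y" for x y z
    by (metis B_add B_sym)
  have B_zero: "B 0 z = 0" for z
    using B_add[of 0 0 z] by (simp only: add_0 add_cancel_right_right)
  have B_neg: "B (- x) z = - B x z" for x z
    using B_add[of x "- x" z] by (simp add: B_zero eq_neg_iff_add_eq_0 add.commute)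
  \<comment> \<open>This is the polarisation of \<open>cross\<close> in \<open>a\<close>.\<close>
  have swap: "m (m u a) b = - m (m u b) a + 2 *s ((2 * B a b) *s u - B a u *s b - B b u *s a)"
    for u a b
  proof -
    have "m (m u a) b + m (m u b) a = 2 *s ((B a b + B b a) *s u - B a u *s b - B b u *s a)"
      using cross[of u "a + b"] cross[of u a] cross[of u b]
      by (simp add: m_simps B_add B_add' scale_simps algebra_simps)
    also have "B a b + B b a = 2 * B a b"
      using B_sym[of a b] by simp
    finally show ?thesis
      by (metis add_diff_cancel_left' diff_conv_add_uminus add.commute)
  qed
  \<comment> \<open>Anticommutativity and \<open>swap\<close> turn each of the other two summands
    into \<open>m (m x y) z\<close> plus terms with \<open>B\<close>, which explains the factor
    3.\<close>
  have jac: "jacobian m x y z = 3 *s (m (m x y) z - (2 * B y z) *s x + (2 * B x z) *s y)" for x y z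
  proof -
    have 1: "m (m z x) y = - m (m x z) y" "m (m y z) x = - m (m z y) x"
      by (metis anti m_simps(8))+
    show ?thesis
      unfolding jacobian_def 1 swap[of z y x] swap[of x z y]
      unfolding 1 swap[of x z y]
      by (simp add: vec_eq_iff B_sym[of y x] B_sym[of z x] B_sym[of z y] algebra_simps)
  qed
  have "jacobian m x y (m x z) = m (jacobian m x y z) x" for x y z
  proof -
    have B1: "B x (m x v) = 0" for v
      by (metis B_inv B_zero m_self)
    have B2: "B (m x y) z = - B y (m x z)"
      by (metis B_inv B_neg anti)
    \<comment> \<open>Written as (zx)(xy), the product has the shape (ua)b with
      \<open>u = z\<close>, \<open>a = x\<close>, \<open>b = m x y\<close>, so that
      \<open>swap\<close> applies to it.\<close>
    have "m (m x y) (m x z) = m (m z x) (m x y)"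
      by (metis anti m_simps(7) minus_minus)
    also have "\<dots> = - m (m z (m x y)) x + 2 *s ((2 * B x (m x y)) *s z - B x z *s m x y - B (m x y) z *s x)"
      by (rule swap)
    also have "m (m z (m x y)) x = - m (m (m x y) z) x"
      by (metis anti m_simps(8))
    finally have "m (m x y) (m x z)
        = m (m (m x y) z) x - (2 * B x z) *s m x y + (2 * B y (m x z)) *s x"
      by (simp add: B1 B2 vec_eq_iff algebra_simps)
    then have "jacobian m x y (m x z) = 3 *s (m (m (m x y) z) x - (2 * B x z) *s m x y)"
      by (simp add: jac B1)
    also have "\<dots> = m (jacobian m x y z) x"
      by (simp add: jac m_simps m_self anti[of y x])
    finally show ?thesis .
  qed
  with alg anti show ?thesis
    unfolding malcev_algebra_def by (intro conjI allI)
qed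

section \<open>The simple algebra in coordinates and its invariant form\<close>

lemma UNIV_mbasis_sum: "(\<Sum>i\<in>UNIV. f i) = f H + f X + f X' + f Y + f Y' + f Z + f Z'"
  by (simp add: UNIV_mbasis add.assoc)

lemma M_mult_nth:
  "M_mult u v $ H = u $ X * v $ X' - u $ X' * v $ X + u $ Y * v $ Y' - u $ Y' * v $ Y
    + u $ Z * v $ Z' - u $ Z' * v $ Z"
  "M_mult u v $ X = 2 * (u $ H * v $ X - u $ X * v $ H - u $ Y' * v $ Z' + u $ Z' * v $ Y')"
  "M_mult u v $ Y = 2 * (u $ H * v $ Y - u $ Y * v $ H - u $ Z' * v $ X' + u $ X' * v $ Z')"
  "M_mult u v $ Z = 2 * (u $ H * v $ Z - u $ Z * v $ H - u $ X' * v $ Y' + u $ Y' * v $ X')"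
  "M_mult u v $ X' = 2 * (u $ X' * v $ H - u $ H * v $ X' + u $ Y * v $ Z - u $ Z * v $ Y)"
  "M_mult u v $ Y' = 2 * (u $ Y' * v $ H - u $ H * v $ Y' + u $ Z * v $ X - u $ X * v $ Z)"
  "M_mult u v $ Z' = 2 * (u $ Z' * v $ H - u $ H * v $ Z' + u $ X * v $ Y - u $ Y * v $ X)"
  by (simp_all add: M_mult_def UNIV_mbasis_sum axis_def)

lemma mbasis_vec_eq_iff: "u = v \<longleftrightarrow> u $ H = v $ H \<and> u $ X = v $ X \<and> u $ X' = v $ X' \<and>
    u $ Y = v $ Y \<and> u $ Y' = v $ Y' \<and> u $ Z = v $ Z \<and> u $ Z' = v $ Z'"
  unfolding vec_eq_iff ball_UNIV[symmetric] UNIV_mbasis by simp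

text \<open>Once x and x' pair to 1, invariance forces the coefficient 2: B(h,h) = B(xx',h) =
  B(x,x'h) = 2B(x,x').\<close>

definition M_form :: "'k::field ^ mbasis \<Rightarrow> 'k ^ mbasis \<Rightarrow> 'k" where
  "M_form u v = 2 * u $ H * v $ H + u $ X * v $ X' + u $ X' * v $ X + u $ Y * v $ Y' + u $ Y' * v $ Y
    + u $ Z * v $ Z' + u $ Z' * v $ Z"

lemma algebra_over_M_mult: "algebra_over (*s) M_mult"
  unfolding algebra_over_def Vector_Spaces.linear_iff
  by (simp add: mbasis_vec_eq_iff M_mult_nth vec.vector_space_axioms algebra_simps)

lemma M_form_M_mult:
  "M_form (M_mult u v) w = M_form u (M_mult v w)" "M_form (M_mult u v) w = M_form v (M_mult w u)"
  by (simp_all add: M_form_def M_mult_nth algebra_simps)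

lemma M_mult_M_mult: "M_mult (M_mult u a) a = 2 *s (M_form a a *s u - M_form a u *s a)"
  by (simp add: mbasis_vec_eq_iff M_mult_nth M_form_def algebra_simps)

lemma M_mult_anticommute: "M_mult u v = - M_mult v u"
  by (simp add: mbasis_vec_eq_iff M_mult_nth algebra_simps)

lemma malcev_algebra_M_mult: "malcev_algebra (*s) M_mult"
proof (rule malcev_algebra_if_cross_product[OF algebra_over_M_mult M_mult_anticommute])
  fix x y z :: "'a ^ mbasis"
  show "M_mult x x = 0"
    by (simp add: mbasis_vec_eq_iff M_mult_nth algebra_simps)
  show "M_form (x + y) z = M_form x z + M_form y z" "M_form x y = M_form y x"
    by (simp_all add: M_form_def algebra_simps)
  show "M_form (M_mult x y) z = M_form x (M_mult y z)"
    by (rule M_form_M_mult(1))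
  show "M_mult (M_mult x y) y = 2 *s (M_form y y *s x - M_form y x *s y)"
    by (rule M_mult_M_mult)
qed

section \<open>Pairings and contractions of tensors\<close>

lemma pairing_simps:
  "pairing f (a + b) = pairing f a + pairing f b" "pairing f (a - b) = pairing f a - pairing f b"
  "pairing f (- a) = - pairing f a" "pairing f (c *s a) = c * pairing f a" "pairing f 0 = 0"
  "pairing (f + g) a = pairing f a + pairing g a" "pairing 0 a = 0"
  by (simp_all add: pairing_def algebra_simps sum.distrib sum_subtractf sum_negf sum_distrib_left)

lemma pairing_sum: "pairing f (sum a K) = (\<Sum>k\<in>K. pairing f (a k))"
  unfolding pairing_def by (simp add: sum_distrib_left) (rule sum.swap)

lemma pairing_eqI: "f = g" if "\<And>a. pairing f a = pairing g a"
  using that[of "bvec _"] by (simp add: pairing_bvec vec_eq_iff)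

lemma contract_right_tensor2: "contract_right f (tensor2 u v) = pairing f v *s u"
  using contract_right_sum[of f "\<lambda>_. u" "\<lambda>_. v" "{()}"] by simp

lemma contract_left_tensor2: "contract_left f (tensor2 u v) = pairing f u *s v"
  using contract_left_sum[of f "\<lambda>_. u" "\<lambda>_. v" "{()}"] by simp

lemma pairing2_tensor2: "pairing2 f g (tensor2 u v) = pairing f u * pairing g v"
  using pairing2_sum[of f g "\<lambda>_. u" "\<lambda>_. v" "{()}"] by simp

lemma linear_contractions:
  "Vector_Spaces.linear (*s) (*s) (contract_right f)"
  "Vector_Spaces.linear (*s) (*s) (contract_left f)"
  "Vector_Spaces.linear (*s) (*) (pairing2 f g)"
  by (auto simp: Vector_Spaces.linear_iff vec.vector_space_axioms vector_space_over_itself.vector_space_axioms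
      contract_right_def contract_left_def pairing2_def vec.scale_left_distrib
      vec.scale_sum_right sum.distrib sum_distrib_left algebra_simps)

interpretation contract_right: Vector_Spaces.linear "(*s)" "(*s)" "contract_right f" for f
  by (rule linear_contractions)

interpretation contract_left: Vector_Spaces.linear "(*s)" "(*s)" "contract_left f" for f
  by (rule linear_contractions)

interpretation pairing2: Vector_Spaces.linear "(*s)" "(*)" "pairing2 f g" for f g
  by (rule linear_contractions)

text \<open>Applied to \<open>cybe\<close>, this map turns the Yang-Baxter equation in the third
  tensor power into an equation in the algebra itself.\<close>

definition contract_last_two :: "'k::field ^ 'n::finite \<Rightarrow> 'k ^ 'n \<Rightarrow> 'k ^ ('n \<times> 'n \<times> 'n) \<Rightarrow> 'k ^ 'n" where
  "contract_last_two f g t = (\<chi> i. \<Sum>k\<in>UNIV. \<Sum>j\<in>UNIV. f $ j * g $ k * t $ (i, j, k))"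

interpretation contract_last_two: Vector_Spaces.linear "(*s)" "(*s)" "contract_last_two f g" for f g
  by (auto simp: Vector_Spaces.linear_iff vec.vector_space_axioms contract_last_two_def vec_eq_iff
      sum.distrib sum_distrib_left algebra_simps)

lemma contract_last_two_tensor3:
  "contract_last_two f g (tensor3 u v w) = (pairing f v * pairing g w) *s u"
  by (simp add: contract_last_two_def tensor3_def pairing_def vec_eq_iff sum_product
      sum_distrib_right sum_distrib_left mult_ac)

section \<open>The double of an antisymmetric solution of the Yang-Baxter equation\<close>

locale triangular =
  fixes m :: "'k::field ^ 'n::finite \<Rightarrow> 'k ^ 'n \<Rightarrow> 'k ^ 'n" and r :: "'k ^ ('n \<times> 'n)"
  assumes alg: "algebra_over (*s) m" and flip: "flip r = - r" and cybe: "cybe m r = 0"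
begin

lemmas m_simps = algebra_over_simps[OF alg]

text \<open>The coefficient of \<open>r\<close> is absorbed into the first tensor factor, so that
  \<open>r\<close> has the shape to which \<open>Delta_sum\<close> and \<open>cybe_sum\<close>
  apply.\<close>

definition lfac :: "'n \<times> 'n \<Rightarrow> 'k ^ 'n" where
  "lfac p = r $ p *s bvec (fst p)"

definition rfac :: "'n \<times> 'n \<Rightarrow> 'k ^ 'n" where
  "rfac p = bvec (snd p)"

lemma r_eq: "r = (\<Sum>p\<in>UNIV. tensor2 (lfac p) (rfac p))"
proof -
  have "tensor2 (lfac p) (rfac p) = r $ p *s tensor2 (bvec (fst p)) (bvec (snd p))" for p
    by (simp add: lfac_def rfac_def tensor2_def vec_eq_iff)
  then show ?thesis
    using tensor2_expansion[of r] by simp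
qed

definition \<rho> :: "'k ^ 'n \<Rightarrow> 'k ^ 'n" where
  "\<rho> f = (\<Sum>p\<in>UNIV. pairing f (rfac p) *s lfac p)"

lemma \<rho>_simps: "\<rho> (f + g) = \<rho> f + \<rho> g" "\<rho> (c *s f) = c *s \<rho> f" "\<rho> 0 = 0"
  by (simp_all add: \<rho>_def pairing_def vec.scale_left_distrib sum.distrib vec.scale_sum_right
      sum_distrib_left algebra_simps)

text \<open>Contracting the first factor of \<open>r\<close> amounts to contracting the second
  factor of \<open>flip r\<close>, which is \<open>- r\<close>.\<close>

lemma \<rho>_antisymmetric: "(\<Sum>p\<in>UNIV. pairing f (lfac p) *s rfac p) = - \<rho> f"
proof -
  have "(\<Sum>p\<in>UNIV. pairing f (lfac p) *s rfac p) = contract_right f (flip r)"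
    by (subst r_eq) (simp add: flip_sum contract_right_sum)
  also have "\<dots> = - contract_right f r"
    by (simp add: flip contract_right.neg)
  also have "contract_right f r = \<rho> f"
    by (subst r_eq) (simp add: contract_right_sum \<rho>_def)
  finally show ?thesis .
qed

lemma linear_pairing_m:
  "Vector_Spaces.linear (*s) (*) (\<lambda>b. pairing f (m a b))"
  "Vector_Spaces.linear (*s) (*) (\<lambda>a. pairing f (m a b))"
  by (auto simp: Vector_Spaces.linear_iff vec.vector_space_axioms
      vector_space_over_itself.vector_space_axioms m_simps pairing_simps)

lemma pairing_harpoon_down:
  "pairing (harpoon_down_left m f a) b = pairing f (m a b)"
  "pairing (harpoon_down_right m b f) a = pairing f (m a b)"
  by (simp_all add: harpoon_down_left_def harpoon_down_right_def pairing_dual_of linear_pairing_m)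

lemma harpoon_down_simps:
  "harpoon_down_left m f (a + b) = harpoon_down_left m f a + harpoon_down_left m f b"
  "harpoon_down_left m f 0 = 0"
  "harpoon_down_right m (a + b) f = harpoon_down_right m a f + harpoon_down_right m b f"
  "harpoon_down_right m 0 f = 0"
  by (rule pairing_eqI; simp add: pairing_harpoon_down pairing_simps m_simps)+

lemma Delta_r: "Delta m r a = (\<Sum>p\<in>UNIV. tensor2 (m (lfac p) a) (rfac p) - tensor2 (lfac p) (m a (rfac p)))"
  by (subst r_eq) (rule Delta_sum[OF alg])

lemma linear_Delta: "Vector_Spaces.linear (*s) (*s) (Delta m r)"
  by (auto simp: Vector_Spaces.linear_iff vec.vector_space_axioms Delta_def m_simps vec_eq_iff
      tensor2_def sum.distrib sum_subtractf sum_distrib_left algebra_simps)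

text \<open>The subtracted term here and the one in \<open>harpoon_up_left_Delta\<close> are the
  values of \<open>\<rho>\<close> at the actions that occur in the dual component of the double. In
  \<open>proj_double\<close> they cancel.\<close>

lemma harpoon_up_right_Delta:
  "harpoon_up_right (Delta m r) f b = m (\<rho> f) b - \<rho> (harpoon_down_left m f b)"
  by (simp add: harpoon_up_right_def Delta_r contract_right.sum contract_right.diff
      contract_right_tensor2 \<rho>_def m_simps pairing_harpoon_down sum_subtractf)

lemma harpoon_up_left_Delta:
  "harpoon_up_left (Delta m r) a g = m a (\<rho> g) - \<rho> (harpoon_down_right m a g)"
proof -
  have "harpoon_up_left (Delta m r) a g
      = (\<Sum>p\<in>UNIV. pairing (harpoon_down_right m a g) (lfac p) *s rfac p)
        - m a (\<Sum>p\<in>UNIV. pairing g (lfac p) *s rfac p)"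
    by (simp add: harpoon_up_left_def Delta_r contract_left.sum contract_left.diff
        contract_left_tensor2 m_simps pairing_harpoon_down sum_subtractf)
  then show ?thesis
    by (simp add: \<rho>_antisymmetric m_simps)
qed

text \<open>Evaluated at \<open>c\<close>, the first half of \<open>Delta\<close> pairs
  \<open>f\<close> with \<open>m (\<rho> g) c\<close>. The second half contracts the first factor of
  \<open>r\<close> with \<open>f\<close>, and antisymmetry makes the resulting sign
  positive.\<close>

lemma dual_mult_Delta:
  "dual_mult (Delta m r) f g = harpoon_down_left m f (\<rho> g) + harpoon_down_right m (\<rho> f) g"
proof (rule pairing_eqI)
  fix c
  interpret Vector_Spaces.linear "(*s)" "(*s)" "Delta m r"
    by (rule linear_Delta)
  have lin: "Vector_Spaces.linear (*s) (*) (\<lambda>a. pairing2 f g (Delta m r a))"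
    by (auto simp: Vector_Spaces.linear_iff vec.vector_space_axioms
        vector_space_over_itself.vector_space_axioms add scale pairing2.add pairing2.scale)
  have "pairing2 f g (Delta m r c)
      = (\<Sum>p\<in>UNIV. pairing f (m (lfac p) c) * pairing g (rfac p))
        - pairing g (m c (\<Sum>p\<in>UNIV. pairing f (lfac p) *s rfac p))"
    by (simp add: Delta_r pairing2.sum pairing2.diff pairing2_tensor2 m_simps pairing_simps
        pairing_sum sum_subtractf)
  also have "\<dots> = pairing f (m (\<rho> g) c) + pairing g (m c (\<rho> f))"
    by (simp add: \<rho>_antisymmetric) (simp add: \<rho>_def m_simps pairing_simps pairing_sum mult.commute)
  finally show "pairing (dual_mult (Delta m r) f g) c
      = pairing (harpoon_down_left m f (\<rho> g) + harpoon_down_right m (\<rho> f) g) c"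
    by (simp add: dual_mult_def pairing_dual_of[OF lin] pairing_simps pairing_harpoon_down)
qed

text \<open>Contracting the last two factors of \<open>cybe m r\<close> with \<open>f\<close> and
  \<open>g\<close> produces \<open>m (\<rho> f) (\<rho> g)\<close> minus \<open>\<rho>\<close> of
  the two summands in \<open>dual_mult_Delta\<close>. The sign of the last summand comes from
  antisymmetry.\<close>

lemma \<rho>_dual_mult: "\<rho> (dual_mult (Delta m r) f g) = m (\<rho> f) (\<rho> g)"
proof -
  let ?c = "contract_last_two f g"
  have "?c (cybe m r) = (\<Sum>i\<in>UNIV. \<Sum>j\<in>UNIV.
      (pairing f (rfac i) * pairing g (rfac j)) *s m (lfac i) (lfac j))
      - (\<Sum>i\<in>UNIV. \<Sum>j\<in>UNIV. (pairing f (m (lfac j) (rfac i)) * pairing g (rfac j)) *s lfac i)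
      + (\<Sum>i\<in>UNIV. \<Sum>j\<in>UNIV. (pairing f (lfac j) * pairing g (m (rfac i) (rfac j))) *s lfac i)"
    by (subst r_eq) (simp add: cybe_sum[OF alg] contract_last_two.sum contract_last_two.add
        contract_last_two.diff contract_last_two_tensor3 sum.distrib sum_subtractf)
  also have "(\<Sum>i\<in>UNIV. \<Sum>j\<in>UNIV. (pairing f (rfac i) * pairing g (rfac j)) *s m (lfac i) (lfac j))
      = m (\<rho> f) (\<rho> g)"
    by (simp add: \<rho>_def m_simps vec.scale_sum_right) (subst sum.swap, simp add: mult.commute)
  also have "(\<Sum>i\<in>UNIV. \<Sum>j\<in>UNIV. (pairing f (m (lfac j) (rfac i)) * pairing g (rfac j)) *s lfac i)
      = \<rho> (harpoon_down_left m f (\<rho> g))"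
    unfolding \<rho>_def[of "harpoon_down_left _ _ _"]
    by (simp add: pairing_harpoon_down)
      (simp add: \<rho>_def m_simps pairing_sum pairing_simps vec.scale_sum_left mult.commute)
  also have "(\<Sum>i\<in>UNIV. \<Sum>j\<in>UNIV. (pairing f (lfac j) * pairing g (m (rfac i) (rfac j))) *s lfac i)
      = (\<Sum>i\<in>UNIV. pairing g (m (rfac i) (\<Sum>j\<in>UNIV. pairing f (lfac j) *s rfac j)) *s lfac i)"
    by (simp add: m_simps pairing_sum pairing_simps vec.scale_sum_left)
  also have "\<dots> = - \<rho> (harpoon_down_right m (\<rho> f) g)"
    by (simp add: \<rho>_antisymmetric \<rho>_def[of "harpoon_down_right _ _ _"] pairing_harpoon_down m_simps
        pairing_simps sum_negf)
  finally have "m (\<rho> f) (\<rho> g) = \<rho> (harpoon_down_left m f (\<rho> g)) + \<rho> (harpoon_down_right m (\<rho> f) g)"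
    by (simp add: cybe contract_last_two.zero algebra_simps)
  then show ?thesis
    by (simp add: dual_mult_Delta \<rho>_simps)
qed

abbreviation double :: "('k ^ 'n) \<times> ('k ^ 'n) \<Rightarrow> ('k ^ 'n) \<times> ('k ^ 'n) \<Rightarrow> ('k ^ 'n) \<times> ('k ^ 'n)" where
  "double \<equiv> double_mult m (Delta m r)"

definition proj :: "('k ^ 'n) \<times> ('k ^ 'n) \<Rightarrow> 'k ^ 'n" where
  "proj v = fst v + \<rho> (snd v)"

lemma linear_proj: "Vector_Spaces.linear double_scale (*s) proj"
  by (simp add: Vector_Spaces.linear_iff vector_space_double_scale vec.vector_space_axioms proj_def
      \<rho>_simps double_scale_def vec.scale_right_distrib)

lemma surj_proj: "surj proj"
proof
  show "UNIV \<subseteq> range proj"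
  proof
    fix a
    have "a = proj (a, 0)"
      by (simp add: proj_def \<rho>_simps)
    then show "a \<in> range proj"
      by simp
  qed
qed simp

lemma proj_double: "proj (double u v) = m (proj u) (proj v)"
  by (cases u, cases v)
    (simp add: proj_def harpoon_up_right_Delta harpoon_up_left_Delta \<rho>_simps \<rho>_dual_mult m_simps)

text \<open>Relative to the components \<open>proj\<close> and \<open>snd\<close>, only the action
  of the algebra on its dual remains and the dual multiplies trivially with itself: a split null
  extension.\<close>

lemma snd_double:
  "snd (double u v) = harpoon_down_left m (snd u) (proj v) + harpoon_down_right m (proj u) (snd v)"
  by (cases u, cases v) (simp add: proj_def dual_mult_Delta harpoon_down_simps)

text \<open>If the bimodules \<open>A\<^sup>*\<close> and \<open>A\<close> are isomorphic, then \<open>a + f \<mapsto> a + \<rho>(f) + \<epsilon>\<theta>(f)\<close> is an isomorphism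
  from the double onto \<open>A[\<epsilon>]\<close>.\<close>

lemma malcev_algebra_double:
  assumes "malcev_algebra (*s) m" and \<theta>: "Vector_Spaces.linear (*s) (*s) \<theta>" "inj \<theta>"
    and down: "\<And>f a. \<theta> (harpoon_down_left m f a) = m (\<theta> f) a"
      "\<And>f a. \<theta> (harpoon_down_right m a f) = m a (\<theta> f)"
  shows "malcev_algebra double_scale double"
proof (rule malcev_algebra_pullback[where \<phi> = "\<lambda>v. (proj v, \<theta> (snd v))"])
  interpret \<theta>: Vector_Spaces.linear "(*s)" "(*s)" \<theta> by fact
  show "malcev_algebra double_scale (dual_number_mult m)"
    using assms(1) by (rule malcev_algebra_dual_number_mult)
  show "Vector_Spaces.linear double_scale double_scale (\<lambda>v. (proj v, \<theta> (snd v)))"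
    by (simp add: Vector_Spaces.linear_iff vector_space_double_scale proj_def \<rho>_simps \<theta>.add \<theta>.scale
        double_scale_def vec.scale_right_distrib)
  show "inj (\<lambda>v. (proj v, \<theta> (snd v)))"
    by (rule injI) (auto simp: proj_def prod_eq_iff dest: injD[OF \<open>inj \<theta>\<close>])
  show "(proj (double u v), \<theta> (snd (double u v)))
      = dual_number_mult m (proj u, \<theta> (snd u)) (proj v, \<theta> (snd v))" for u v
    by (simp add: proj_double snd_double \<theta>.add down dual_number_mult_def add.commute)
qed

text \<open>Both \<open>proj\<close> and \<open>snd\<close> vanish on a product of two kernel
  elements, so the kernel is an abelian ideal and its derived series is zero after one step.\<close>

lemma solvable_ideal_kernel: "solvable_ideal double_scale double {v. proj v = 0}"
proof -
  interpret vector_space double_scale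
    by (rule vector_space_double_scale)
  interpret proj: Vector_Spaces.linear double_scale "(*s)" proj
    by (rule linear_proj)
  have ideal: "algebra_ideal double_scale double {v. proj v = 0}"
    by (auto simp: algebra_ideal_def subspace_def proj.zero proj.add proj.scale proj_double m_simps)
  have "double u v = 0" if "proj u = 0" "proj v = 0" for u v
  proof -
    have "snd (double u v) = 0"
      by (simp add: snd_double that harpoon_down_simps)
    moreover have "proj (double u v) = 0"
      by (simp add: proj_double that m_simps)
    ultimately show ?thesis
      by (simp add: prod_eq_iff proj_def \<rho>_simps)
  qed
  then have "{double u v | u v. u \<in> {v. proj v = 0} \<and> v \<in> {v. proj v = 0}} \<subseteq> {0}"
    by auto
  from span_mono[OF this]
  have "derived_series double_scale double {v. proj v = 0} 1 = {0}"
    by (auto simp: span_zero)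
  with ideal show ?thesis
    unfolding solvable_ideal_def by blast
qed

end

section \<open>Solvable ideals under homomorphisms onto simple perfect algebras\<close>

text \<open>The image of \<open>I\<close> is an ideal, hence zero or everything. If it is
  everything, perfectness keeps every term of the derived series surjective, including the term that
  is zero.\<close>

lemma solvable_ideal_image_trivial:
  assumes I: "solvable_ideal s m I" and \<pi>: "Vector_Spaces.linear s s' \<pi>" "surj \<pi>"
    and hom: "\<And>u v. \<pi> (m u v) = m' (\<pi> u) (\<pi> v)"
    and simple: "\<And>J. algebra_ideal s' m' J \<Longrightarrow> J = {0} \<or> J = UNIV"
    and perfect: "module.span s' {m' u v | u v. True} = UNIV"
  shows "\<pi> ` I = {0}"
proof -
  interpret \<pi>: Vector_Spaces.linear s s' \<pi> by fact
  from I obtain n where ideal: "algebra_ideal s m I" and n: "derived_series s m I n = {0}"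
    by (auto simp: solvable_ideal_def)
  have "algebra_ideal s' m' (\<pi> ` I)"
  proof -
    have "m' a (\<pi> u) \<in> \<pi> ` I \<and> m' (\<pi> u) a \<in> \<pi> ` I" if "u \<in> I" for a u
    proof -
      obtain b where "a = \<pi> b"
        using \<open>surj \<pi>\<close> by blast
      with ideal that show ?thesis
        by (auto simp: algebra_ideal_def hom[symmetric])
    qed
    with ideal show ?thesis
      by (auto simp: algebra_ideal_def intro: \<pi>.subspace_image)
  qed
  then consider "\<pi> ` I = {0}" | "\<pi> ` I = UNIV"
    using simple by blast
  then show ?thesis
  proof cases
    case 2
    have "\<pi> ` derived_series s m I k = UNIV" for k
    proof (induction k)
      case 0
      then show ?case
        using 2 by simp
    next
      case (Suc k)
      let ?D = "derived_series s m I k"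
      have "{m' a b | a b. True} \<subseteq> \<pi> ` {m u v | u v. u \<in> ?D \<and> v \<in> ?D}"
      proof clarify
        fix a b
        obtain u v where "u \<in> ?D" "v \<in> ?D" "a = \<pi> u" "b = \<pi> v"
          using Suc by (metis UNIV_I imageE)
        then show "m' a b \<in> \<pi> ` {m u v | u v. u \<in> ?D \<and> v \<in> ?D}"
          by (auto simp: hom[symmetric])
      qed
      from \<pi>.vs2.span_mono[OF this] show ?case
        unfolding perfect by (simp add: top_unique \<pi>.span_image[symmetric])
    qed
    with n have "\<pi> ` {0} = UNIV"
      by metis
    \<comment> \<open>The target is then the zero space, so that the full image is
      \<open>{0}\<close> as well.\<close>
    with 2 show ?thesis
      by (simp add: \<pi>.zero)
  qed
qed

section \<open>Simplicity, perfectness and self-duality of the simple algebra\<close>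

lemma two_neq_zero: "(2 :: 'k::field) \<noteq> 0" if "CHAR('k) \<noteq> 2"
proof
  assume "(2 :: 'k) = 0"
  then have "CHAR('k) dvd 2"
    using of_nat_eq_0_iff_char_dvd[of 2, where ?'a = 'k] by simp
  with that show False
    using CHAR_not_1'[where ?'a = 'k] two_is_prime_nat by (auto simp: prime_nat_iff)
qed

text \<open>Pairing with the seven basis vectors reads off all coordinates, the one at
  \<open>H\<close> with a factor 2.\<close>

lemma M_form_nondegenerate:
  fixes u v :: "'k::field ^ mbasis"
  assumes "(2 :: 'k) \<noteq> 0" and "\<And>a. M_form u a = M_form v a"
  shows "u = v"
  using assms(2)[of "bvec H"] assms(2)[of "bvec X"] assms(2)[of "bvec X'"] assms(2)[of "bvec Y"]
    assms(2)[of "bvec Y'"] assms(2)[of "bvec Z"] assms(2)[of "bvec Z'"] assms(1)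
  by (simp add: M_form_def axis_def mbasis_vec_eq_iff)

text \<open>Multiplication by h is diagonal, with eigenvalue 2 or -2 on every basis vector other
  than h, hence invertible there.\<close>

lemma M_mult_bvec_H_surj:
  fixes u :: "'k::field ^ mbasis"
  assumes "(2 :: 'k) \<noteq> 0"
  obtains w where "u = u $ H *s bvec H + M_mult (bvec H) w"
proof
  define w where "w = (\<chi> i. case i of H \<Rightarrow> 0 | X \<Rightarrow> u $ X / 2 | X' \<Rightarrow> - (u $ X' / 2)
    | Y \<Rightarrow> u $ Y / 2 | Y' \<Rightarrow> - (u $ Y' / 2) | Z \<Rightarrow> u $ Z / 2 | Z' \<Rightarrow> - (u $ Z' / 2))"
  show "u = u $ H *s bvec H + M_mult (bvec H) w"
    using assms by (simp add: mbasis_vec_eq_iff M_mult_nth w_def axis_def)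
qed

text \<open>The six left factors are isotropic, and the form with them reads off the six coordinates
  of a vector other than that at \<open>H\<close>.\<close>

lemma M_mult_bvec:
  "M_mult (bvec X) (bvec X') = bvec H" "M_mult (bvec X') (- bvec X) = bvec H"
  "M_mult (bvec Y) (bvec Y') = bvec H" "M_mult (bvec Y') (- bvec Y) = bvec H"
  "M_mult (bvec Z) (bvec Z') = bvec H" "M_mult (bvec Z') (- bvec Z) = bvec H"
  by (simp_all add: mbasis_vec_eq_iff M_mult_nth axis_def)

text \<open>If \<open>a\<close> is isotropic and not orthogonal to \<open>u\<close>, then \<open>(ua)a\<close> is a nonzero multiple of \<open>a\<close>.\<close>

lemma M_mult_simple:
  fixes J :: "('k::field ^ mbasis) set"
  assumes two: "(2 :: 'k) \<noteq> 0" and J: "algebra_ideal (*s) M_mult J"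
  shows "J = {0} \<or> J = UNIV"
proof (subst disj_commute, rule disjCI)
  assume "J \<noteq> {0}"
  have sub: "vec.subspace J" and mult: "\<And>a u. u \<in> J \<Longrightarrow> M_mult u a \<in> J"
    using J by (auto simp: algebra_ideal_def)
  have "0 \<in> J"
    using sub by (rule vec.subspace_0)
  with \<open>J \<noteq> {0}\<close> obtain u where u: "u \<in> J" "u \<noteq> 0"
    by blast
  have unscale: "a \<in> J" if "c *s a \<in> J" "c \<noteq> 0" for a c
    using vec.subspace_scale[OF sub that(1), of "inverse c"] that(2) by simp
  have H_if: "bvec H \<in> J" if "M_form a a = 0" "M_form a u \<noteq> 0" "M_mult a b = bvec H" for a b
  proof -
    have "M_mult (M_mult u a) a = (- 2 * M_form a u) *s a"
      by (simp add: M_mult_M_mult that(1) vec_eq_iff)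
    then have "(- 2 * M_form a u) *s a \<in> J"
      using u(1) mult by metis
    then have "a \<in> J"
      by (rule unscale) (simp add: two that(2))
    with mult that(3) show ?thesis
      by metis
  qed
  note H_ifs = H_if[OF _ _ M_mult_bvec(1)] H_if[OF _ _ M_mult_bvec(2)] H_if[OF _ _ M_mult_bvec(3)]
    H_if[OF _ _ M_mult_bvec(4)] H_if[OF _ _ M_mult_bvec(5)] H_if[OF _ _ M_mult_bvec(6)]
  have "bvec H \<in> J"
  proof (rule ccontr)
    assume no: "bvec H \<notin> J"
    \<comment> \<open>A nonzero coordinate would provide an isotropic basis vector not orthogonal to
      \<open>u\<close>, which then lies in \<open>J\<close> and has h as a multiple.\<close>
    then have "u $ X' = 0" "u $ X = 0" "u $ Y' = 0" "u $ Y = 0" "u $ Z' = 0" "u $ Z = 0"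
      using H_ifs by (auto simp: M_form_def axis_def)
    then have "u = u $ H *s bvec H" "u $ H \<noteq> 0"
      using u(2) by (auto simp: mbasis_vec_eq_iff axis_def)
    with u(1) no show False
      using unscale by metis
  qed
  then have "v \<in> J" for v
    using M_mult_bvec_H_surj[OF two, of v] sub mult
    by (metis vec.subspace_add vec.subspace_scale)
  then show "J = UNIV"
    by blast
qed

text \<open>As h = xx' is itself a product, \<open>M_mult_bvec_H_surj\<close> writes every vector as
  a combination of two products.\<close>

lemma M_mult_perfect:
  assumes "(2 :: 'k::field) \<noteq> 0"
  shows "vec.span {M_mult u v | u v :: 'k ^ mbasis. True} = UNIV"
proof -
  have "v \<in> vec.span {M_mult u v | u v :: 'k ^ mbasis. True}" for v :: "'k ^ mbasis"
  proof -
    obtain w where w: "v = v $ H *s M_mult (bvec X) (bvec X') + M_mult (bvec H) w"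
      using M_mult_bvec_H_surj[OF assms] M_mult_bvec(1) by metis
    show ?thesis
      by (subst w) (intro vec.span_add vec.span_scale vec.span_base; blast)
  qed
  then show ?thesis
    by blast
qed

text \<open>This is the identification of the dual with the algebra through \<open>M_form\<close>;
  the division by 2 compensates for B(h,h) = 2.\<close>

definition M_sharp :: "'k::field ^ mbasis \<Rightarrow> 'k ^ mbasis" where
  "M_sharp f = (\<chi> i. case i of H \<Rightarrow> f $ H / 2 | X \<Rightarrow> f $ X' | X' \<Rightarrow> f $ X
    | Y \<Rightarrow> f $ Y' | Y' \<Rightarrow> f $ Y | Z \<Rightarrow> f $ Z' | Z' \<Rightarrow> f $ Z)"

lemma M_form_M_sharp:
  fixes f a :: "'k::field ^ mbasis"
  assumes "(2 :: 'k) \<noteq> 0"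
  shows "M_form (M_sharp f) a = pairing f a"
  using assms by (simp add: M_form_def M_sharp_def pairing_def UNIV_mbasis_sum algebra_simps)

section \<open>The double of the simple non-Lie Malcev algebra and its radical\<close>

theorem theorem4:
  fixes r :: "'k::alg_closed_field ^ (mbasis \<times> mbasis)"
  assumes "CHAR('k) \<noteq> 2" and "CHAR('k) \<noteq> 3"
    and "flip r = - r"
    and "cybe M_mult r = 0"
  shows "malcev_bialgebra M_mult (Delta M_mult r) \<and>
    (\<exists>R. is_solvable_radical double_scale (double_mult M_mult (Delta M_mult r)) R \<and> R \<noteq> {0})"
proof -
  have two: "(2 :: 'k) \<noteq> 0"
    using assms(1) by (rule two_neq_zero)
  interpret triangular M_mult r
    using algebra_over_M_mult assms(3,4) by unfold_locales
  note sharp = M_form_M_sharp[OF two]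
  have "malcev_algebra double_scale double"
  proof (rule malcev_algebra_double[OF malcev_algebra_M_mult])
    show "Vector_Spaces.linear (*s) (*s) (M_sharp :: 'k ^ mbasis \<Rightarrow> _)"
      by (simp add: Vector_Spaces.linear_iff vec.vector_space_axioms mbasis_vec_eq_iff M_sharp_def
          add_divide_distrib)
    show "inj (M_sharp :: 'k ^ mbasis \<Rightarrow> _)"
      by (rule injI) (metis sharp pairing_eqI)
    fix f a :: "'k ^ mbasis"
    \<comment> \<open>Against any vector, invariance of the form turns the right-hand side into the
      defining pairing of the action; nondegeneracy then gives equality.\<close>
    show "M_sharp (harpoon_down_left M_mult f a) = M_mult (M_sharp f) a"
      by (rule M_form_nondegenerate[OF two])
        (simp add: sharp pairing_harpoon_down M_form_M_mult(1))
    show "M_sharp (harpoon_down_right M_mult a f) = M_mult a (M_sharp f)"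
      by (rule M_form_nondegenerate[OF two])
        (simp add: sharp pairing_harpoon_down M_form_M_mult(2))
  qed
  then have "malcev_bialgebra M_mult (Delta M_mult r)"
    using malcev_algebra_M_mult linear_Delta by (simp add: malcev_bialgebra_def)
  moreover have "is_solvable_radical double_scale double {v. proj v = 0}"
  proof -
    have "proj ` I = {0}" if "solvable_ideal double_scale double I" for I
    proof (rule solvable_ideal_image_trivial[OF that linear_proj surj_proj])
      show "proj (double u v) = M_mult (proj u) (proj v)" for u v
        by (rule proj_double)
      show "J = {0} \<or> J = UNIV" if "algebra_ideal (*s) M_mult J" for J :: "('k ^ mbasis) set"
        using two that by (rule M_mult_simple)
      show "vec.span {M_mult u v | u v :: 'k ^ mbasis. True} = UNIV"
        using two by (rule M_mult_perfect)
    qed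
    then have "I \<subseteq> {v. proj v = 0}" if "solvable_ideal double_scale double I" for I
      using that by blast
    with solvable_ideal_kernel show ?thesis
      by (simp add: is_solvable_radical_def)
  qed
  moreover have "{v. proj v = 0} \<noteq> {0}"
  proof -
    \<comment> \<open>The kernel of \<open>proj\<close> is the graph of \<open>- \<rho>\<close> over
      the dual, so any nonzero functional yields a nonzero element.\<close>
    have "(- \<rho> (bvec H), bvec H) \<in> {v. proj v = 0}"
      by (simp add: proj_def)
    moreover have "(- \<rho> (bvec H), bvec H) \<noteq> 0"
      by (simp add: prod_eq_iff)
    ultimately show ?thesis
      by blast
  qed
  ultimately show ?thesis
    by blast
qed

end
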